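(* Let $F=[\mathbf f_1,\ldots,\mathbf f_s]_{n\times s}\in\mathbb Z[x]^{n\times s}$ be a matrix with entries in $\mathbb Z[x]$. Then $\ker(F)=\{X\in\mathbb Z[x]^s\mid FX=\mathbf 0\}$ is a free $\mathbb Z[x]$-module.
   Context: $\mathbb Z[x]$ is the polynomial ring in one variable over the integers; $\mathbf f_i\in\mathbb Z[x]^n$ is the $i$-th column of $F$. *)

theory Defs
  imports "Jordan_Normal_Form.Matrix_Kernel"
begin

(* A free module is one that has a basis: a linearly independent generating set, which may be
   infinite or empty. The library defines basis for vector spaces only; the body below is that
   definition over an arbitrary commutative ring. Module.module is the HOL-Algebra locale, as
   opposed to the type-class based Modules.module. *)
definition free_module ::
  "('r, 'x) ring_scheme \<Rightarrow> ('r, 'm, 'y) module_scheme \<Rightarrow> bool" where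
  "free_module R M \<longleftrightarrow> Module.module R M \<and>
    (\<exists>B. LinearCombinations.module.lin_indpt R M B \<and>
         LinearCombinations.module.gen_set R M B \<and> B \<subseteq> carrier M)"

definition kernel_module :: "'a :: comm_ring_1 mat \<Rightarrow> ('a, 'a vec) module" where
  "kernel_module A = (module_vec TYPE('a) (dim_col A))\<lparr>carrier := mat_kernel A\<rparr>"

end

theory Submission
  imports Defs
begin

text \<open>
  The kernel is pure: if a prime number \<open>p\<close> divides an element \<open>v\<close> of \<open>K = ker F\<close>, then \<open>v / p\<close>
  lies in \<open>K\<close> again. Every pure submodule \<open>K\<close> of
  \<open>\<int>[x]\<^sup>s\<close> is free, and the basis is found as a family that is extremal in two steps.

  Let \<open>r\<close> be the largest number such that some \<open>r\<close> vectors of \<open>K\<close>, written as the columns of a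
  matrix, have a nonzero \<open>r \<times> r\<close> minor \<open>d\<close>. Among all families of \<open>r\<close> vectors of \<open>K\<close> whose minor
  in the same rows is nonzero, take one whose minor has least degree and, within that degree, a
  leading coefficient of least absolute value. Such a family \<open>v\<^sub>0, \<dots>, v\<^sub>r\<^sub>-\<^sub>1\<close> is a basis.
  It is independent since \<open>d \<noteq> 0\<close>. That it generates \<open>K\<close> is seen as follows; the tool is always
  Cramer's rule in the form of \<open>minor_replace\<close>, which tells how \<open>d\<close> changes when one \<open>v\<^sub>j\<close> is
  exchanged for another vector.

  Over \<open>\<rat>[x]\<close> (\<open>multiple_in_span\<close>). For \<open>w \<in> K\<close>, maximality of \<open>r\<close> gives \<open>d w = \<Sum> c\<^sub>l v\<^sub>l\<close>. Dividing
  the \<open>c\<^sub>l\<close> by \<open>d\<close>, with a common integer \<open>M\<close> as denominator, replaces \<open>M w\<close> by a vector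
  \<open>w' \<in> K\<close> with \<open>d w' = \<Sum> t\<^sub>l v\<^sub>l\<close> and all \<open>t\<^sub>l\<close> zero or of smaller degree than \<open>d\<close>. Exchanging \<open>v\<^sub>j\<close> for
  \<open>w'\<close> would turn the minor into \<open>t\<^sub>j\<close>, so all \<open>t\<^sub>j\<close> vanish, and \<open>M w\<close> lies in the span of the \<open>v\<^sub>l\<close>.

  Modulo primes (\<open>reduced_frame_relation_mod_prime\<close>, \<open>in_span\<close>). To cancel \<open>M\<close> it suffices that the \<open>v\<^sub>l\<close>
  stay independent over \<open>\<F>\<^sub>p[x]\<close> for each prime \<open>p\<close>. This ring is Euclidean, so elementary column
  operations, which lift to \<open>\<int>[x]\<close> and keep the minor, concentrate a nontrivial relation
  modulo \<open>p\<close> in a single column. That column is then divisible by \<open>p\<close>; dividing it by \<open>p\<close> stays in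
  \<open>K\<close> by purity and divides the minor by \<open>p\<close>, against its minimality.
\<close>

section \<open>Maximal minors of a family of vectors\<close>

definition minor :: "nat \<Rightarrow> (nat \<Rightarrow> nat) \<Rightarrow> (nat \<Rightarrow> 'a vec) \<Rightarrow> 'a :: comm_ring_1" where
  "minor r I v = det (mat r r (\<lambda>(i, j). v j $ I i))"

text \<open>
  Cramer's rule: in the chosen rows the vector \<open>a w\<close> is a combination of the columns \<open>v\<^sub>l\<close>, and
  only its \<open>v\<^sub>j\<close>-part contributes to the determinant with \<open>w\<close> in column \<open>j\<close>. Different choices of
  \<open>a\<close> and \<open>c\<close> cover the exchange of a vector, an elementary column operation, the division of a
  column by a scalar, and (with \<open>a = 0\<close>) linear independence.
\<close>

lemma minor_replace:
  assumes j: "j < r" and rel: "\<And>i. i < r \<Longrightarrow> a * w $ I i = (\<Sum>l<r. c l * v l $ I i)"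
  shows "a * minor r I (v(j := w)) = c j * minor r I v"
proof -
  define G where "G = mat r r (\<lambda>(i, l). v l $ I i)"
  define G' where "G' = mat r r (\<lambda>(i, l). (v(j := w)) l $ I i)"
  define x where "x = vec r c"
  have G: "G \<in> carrier_mat r r" and G': "G' \<in> carrier_mat r r"
    by (auto simp: G_def G'_def)
  \<comment> \<open>Both sides describe \<open>G\<close> with column \<open>j\<close> exchanged for the chosen rows of \<open>a w\<close>, so the
    determinant can be evaluated by Cramer's rule for \<open>G\<close> and for \<open>G'\<close>.\<close>
  have "replace_col G (G *\<^sub>v x) j = replace_col G' (G' *\<^sub>v (a \<cdot>\<^sub>v unit_vec r j)) j"
  proof (rule eq_matI)
    fix i l assume "i < dim_row (replace_col G' (G' *\<^sub>v (a \<cdot>\<^sub>v unit_vec r j)) j)"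
      and "l < dim_col (replace_col G' (G' *\<^sub>v (a \<cdot>\<^sub>v unit_vec r j)) j)"
    hence i: "i < r" and l: "l < r" by (auto simp: replace_col_def G'_def)
    have "(G *\<^sub>v x) $ i = (\<Sum>l<r. v l $ I i * c l)"
      using i by (simp add: G_def x_def scalar_prod_def lessThan_atLeast0)
    also have "\<dots> = a * w $ I i" by (simp add: rel[OF i] mult.commute)
    also have "\<dots> = (G' *\<^sub>v (a \<cdot>\<^sub>v unit_vec r j)) $ i"
      using i j by (simp add: G'_def mult_mat_vec[of _ r r])
    finally show "replace_col G (G *\<^sub>v x) j $$ (i, l)
        = replace_col G' (G' *\<^sub>v (a \<cdot>\<^sub>v unit_vec r j)) j $$ (i, l)"
      using i l by (simp add: replace_col_def G_def G'_def)
  qed (auto simp: replace_col_def G_def G'_def)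
  hence "x $ j * det G = (a \<cdot>\<^sub>v unit_vec r j) $ j * det G'"
    using cramer_lemma_mat[OF G _ j, of x] cramer_lemma_mat[OF G' _ j, of "a \<cdot>\<^sub>v unit_vec r j"]
    by (simp add: x_def)
  thus ?thesis using j by (simp add: x_def G_def G'_def minor_def)
qed

lemma minor_solve:
  obtains c where "\<And>i. i < r \<Longrightarrow> minor r I v * w $ I i = (\<Sum>l<r. c l * v l $ I i)"
proof -
  define G where "G = mat r r (\<lambda>(i, l). v l $ I i)"
  define b where "b = vec r (\<lambda>i. w $ I i)"
  define x where "x = adj_mat G *\<^sub>v b"
  have G: "G \<in> carrier_mat r r" and b: "b \<in> carrier_vec r" by (auto simp: G_def b_def)
  have x: "x \<in> carrier_vec r" using adj_mat(1)[OF G] b unfolding x_def by (rule mult_mat_vec_carrier)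
  have "G *\<^sub>v x = (G * adj_mat G) *\<^sub>v b"
    unfolding x_def by (rule assoc_mult_mat_vec[symmetric, OF G adj_mat(1)[OF G] b])
  also have "\<dots> = det G \<cdot>\<^sub>v b"
    using b unfolding adj_mat(2)[OF G] by (intro eq_vecI) (auto simp: smult_scalar_prod_distrib[of _ r])
  finally have eq: "G *\<^sub>v x = det G \<cdot>\<^sub>v b" .
  show ?thesis
  proof (rule that[of "\<lambda>l. x $ l"])
    fix i assume i: "i < r"
    have "minor r I v * w $ I i = (G *\<^sub>v x) $ i"
      unfolding eq using i by (simp add: b_def minor_def G_def)
    also have "\<dots> = (\<Sum>l<r. v l $ I i * x $ l)"
      using i x by (simp add: G_def scalar_prod_def lessThan_atLeast0)
    finally show "minor r I v * w $ I i = (\<Sum>l<r. x $ l * v l $ I i)"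
      by (simp add: mult.commute)
  qed
qed

text \<open>
  This is what forbids a nonzero vector vanishing in the rows \<open>I\<close> when \<open>r\<close> is maximal: the
  enlarged matrix is block triangular with the diagonal blocks of the old minor and \<open>u\<^sub>k\<close>.
\<close>

lemma minor_extend:
  assumes "\<And>i. i < r \<Longrightarrow> u $ I i = 0"
  shows "minor (Suc r) (I(r := k)) (v(r := u)) = u $ k * minor r I v"
proof -
  let ?A = "mat (Suc r) (Suc r) (\<lambda>(i, j). (v(r := u)) j $ (I(r := k)) i)"
  have del: "mat_delete ?A r r = mat r r (\<lambda>(i, j). v j $ I i)"
    by (rule eq_matI) (auto simp: mat_delete_def)
  have "det ?A = (\<Sum>i<Suc r. ?A $$ (i, r) * cofactor ?A i r)"
    by (rule laplace_expansion_column) auto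
  also have "\<dots> = u $ k * cofactor ?A r r"
    using assms by simp
  also have "\<dots> = u $ k * minor r I v"
    unfolding cofactor_def del minor_def by simp
  finally show ?thesis by (simp add: minor_def)
qed

lemma minor_nonzero_le:
  assumes "minor r I v \<noteq> 0" and I: "\<And>i. i < r \<Longrightarrow> I i < s"
  shows "r \<le> s"
proof (rule ccontr)
  assume "\<not> r \<le> s"
  moreover have "I ` {..<r} \<subseteq> {..<s}" using I by auto
  ultimately have "\<not> inj_on I {..<r}"
    by (metis card_inj_on_le card_lessThan finite_lessThan)
  then obtain i j where ij: "i < r" "j < r" "i \<noteq> j" "I i = I j"
    by (auto simp: inj_on_def)
  have "minor r I v = 0"
    unfolding minor_def
    by (rule det_identical_rows[OF _ ij(3,1,2)]) (use ij in \<open>auto intro!: eq_vecI\<close>)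
  with assms show False by simp
qed

section \<open>Reduced frames of pure submodules\<close>

text \<open>
  Purity says that the quotient \<open>\<int>[x]\<^sup>s / K\<close> has no \<open>\<int>\<close>-torsion. It cannot be dropped: the ideal
  \<open>(2, x)\<close> of \<open>\<int>[x]\<close> is a submodule of \<open>\<int>[x]\<^sup>1\<close> that is not free.
\<close>

locale pure_submodule =
  fixes s :: nat and K :: "int poly vec set"
  assumes K_carrier: "K \<subseteq> carrier_vec s"
    and K_zero: "0\<^sub>v s \<in> K"
    and K_add: "\<And>u v. u \<in> K \<Longrightarrow> v \<in> K \<Longrightarrow> u + v \<in> K"
    and K_smult: "\<And>a v. v \<in> K \<Longrightarrow> a \<cdot>\<^sub>v v \<in> K"
    and K_pure: "\<And>p v. prime p \<Longrightarrow> v \<in> carrier_vec s \<Longrightarrow> [:p:] \<cdot>\<^sub>v v \<in> K \<Longrightarrow> v \<in> K"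
begin

definition comb :: "nat \<Rightarrow> (nat \<Rightarrow> int poly) \<Rightarrow> (nat \<Rightarrow> int poly vec) \<Rightarrow> int poly vec" where
  "comb r c v = vec s (\<lambda>k. \<Sum>l<r. c l * v l $ k)"

lemma comb_in_K:
  assumes "\<And>l. l < r \<Longrightarrow> v l \<in> K"
  shows "comb r c v \<in> K"
  using assms
proof (induction r)
  case 0
  have "comb 0 c v = 0\<^sub>v s" by (auto simp: comb_def)
  thus ?case using K_zero by simp
next
  case (Suc r)
  have "v r \<in> K" using Suc.prems by simp
  moreover have "v r \<in> carrier_vec s" using calculation K_carrier by auto
  hence "comb (Suc r) c v = comb r c v + c r \<cdot>\<^sub>v v r"
    by (intro eq_vecI) (auto simp: comb_def)
  moreover have "comb r c v \<in> K" using Suc by simp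
  ultimately show ?case using K_add K_smult by simp
qed

definition frame :: "nat \<Rightarrow> (nat \<Rightarrow> nat) \<Rightarrow> (nat \<Rightarrow> int poly vec) \<Rightarrow> bool" where
  "frame r I v \<longleftrightarrow> (\<forall>l<r. v l \<in> K \<and> I l < s) \<and> minor r I v \<noteq> 0"

text \<open>
  The degree drops when division with remainder over \<open>\<rat>[x]\<close> succeeds, the leading coefficient when
  a prime number is divided out. A well-founded order on the minors is needed for which both are
  progress.
\<close>

definition smaller :: "(int poly \<times> int poly) set" where
  "smaller = measures [degree, \<lambda>d. nat \<bar>lead_coeff d\<bar>]"

definition reduced_frame :: "nat \<Rightarrow> (nat \<Rightarrow> nat) \<Rightarrow> (nat \<Rightarrow> int poly vec) \<Rightarrow> bool" where
  "reduced_frame r I v \<longleftrightarrow> frame r I v \<and>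
     (\<forall>v'. frame r I v' \<longrightarrow> (minor r I v', minor r I v) \<notin> smaller)"

lemma frame_update:
  assumes "frame r I v" "w \<in> K" "minor r I (v(j := w)) \<noteq> 0"
  shows "frame r I (v(j := w))"
  using assms by (auto simp: frame_def)

lemma obtain_reduced_frame:
  obtains r I v where "reduced_frame r I v" and "\<And>I' v'. \<not> frame (Suc r) I' v'"
proof -
  define P where "P = (\<lambda>r. \<exists>I v. frame r I v)"
  have "P 0" by (auto simp: P_def frame_def minor_def)
  moreover have bound: "r \<le> s" if "P r" for r
    using that minor_nonzero_le[where s = s] by (auto simp: P_def frame_def)
  ultimately obtain r where r: "P r" and max: "\<And>r'. P r' \<Longrightarrow> r' \<le> r"
    by (metis (no_types) GreatestI_nat Greatest_le_nat)
  from r obtain I v0 where "frame r I v0" by (auto simp: P_def)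
  hence "minor r I v0 \<in> minor r I ` {v. frame r I v}" by simp
  moreover have "wf smaller" by (simp add: smaller_def)
  ultimately obtain d where "d \<in> minor r I ` {v. frame r I v}"
    and "\<And>d'. (d', d) \<in> smaller \<Longrightarrow> d' \<notin> minor r I ` {v. frame r I v}"
    by (metis wfE_min)
  then obtain v where "reduced_frame r I v"
    by (auto simp: reduced_frame_def)
  moreover have "\<not> frame (Suc r) I' v'" for I' v'
    using max[of "Suc r"] by (auto simp: P_def)
  ultimately show ?thesis using that by blast
qed

section \<open>Reduced frames generate\<close>

text \<open>
  A vector of \<open>K\<close> outside the \<open>\<rat>[x]\<close>-span would leave a remainder modulo the minor, and exchanging it for
  some \<open>v\<^sub>j\<close> would lower the degree of the minor.
\<close>

lemma multiple_in_span:
  assumes red: "reduced_frame r I v" and max: "\<And>I' v'. \<not> frame (Suc r) I' v'"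
    and w: "w \<in> K"
  obtains m c where "m > (0::int)" "[:m:] \<cdot>\<^sub>v w = comb r c v"
proof -
  let ?d = "minor r I v"
  have fr: "frame r I v" using red by (simp add: reduced_frame_def)
  hence vK: "\<And>l. l < r \<Longrightarrow> v l \<in> K" and Is: "\<And>l. l < r \<Longrightarrow> I l < s" and d0: "?d \<noteq> 0"
    by (auto simp: frame_def)
  have wc: "w \<in> carrier_vec s" using w K_carrier by auto
  have cramer: "\<exists>c. ?d \<cdot>\<^sub>v w = comb r c v" if w: "w \<in> K" for w
  proof -
    have wc: "w \<in> carrier_vec s" using w K_carrier by auto
    obtain c where c: "\<And>i. i < r \<Longrightarrow> ?d * w $ I i = (\<Sum>l<r. c l * v l $ I i)"
      using minor_solve by blast
    define u where "u = ?d \<cdot>\<^sub>v w + (- 1) \<cdot>\<^sub>v comb r c v"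
    have uK: "u \<in> K" unfolding u_def by (intro K_add K_smult w comb_in_K vK)
    have uk: "u $ k = ?d * w $ k - (\<Sum>l<r. c l * v l $ k)" if "k < s" for k
      using that wc by (simp add: u_def comb_def)
    have "u $ k = 0" if k: "k < s" for k
    proof (rule ccontr)
      assume "u $ k \<noteq> 0"
      hence "minor (Suc r) (I(r := k)) (v(r := u)) \<noteq> 0"
        using d0 by (subst minor_extend) (auto simp: uk Is c)
      hence "frame (Suc r) (I(r := k)) (v(r := u))"
        using fr uK k by (auto simp: frame_def less_Suc_eq)
      thus False using max by blast
    qed
    hence "?d \<cdot>\<^sub>v w = comb r c v"
      using uk wc by (intro eq_vecI) (auto simp: comb_def)
    thus ?thesis by blast
  qed
  then obtain c where c: "?d \<cdot>\<^sub>v w = comb r c v" using w by blast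
  \<comment> \<open>Pseudo-division gives each \<open>c l\<close> its own integer factor \<open>m0 l\<close>; multiplying by the other
    factors \<open>e l\<close> brings all of them to the common factor \<open>M\<close>.\<close>
  have "\<forall>l. \<exists>x. fst x \<noteq> 0 \<and>
      Polynomial.smult (fst x) (c l) = ?d * snd x + pseudo_mod (c l) ?d"
    using pseudo_mod(1)[OF d0] by simp
  then obtain mq where mq: "\<forall>l. fst (mq l) \<noteq> 0 \<and>
      Polynomial.smult (fst (mq l)) (c l) = ?d * snd (mq l) + pseudo_mod (c l) ?d"
    by (rule choice[THEN exE])
  define m0 where "m0 = (\<lambda>l. fst (mq l))"
  define q0 where "q0 = (\<lambda>l. snd (mq l))"
  hence m0: "\<And>l. m0 l \<noteq> 0"
    and q0: "\<And>l. Polynomial.smult (m0 l) (c l) = ?d * q0 l + pseudo_mod (c l) ?d"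
    using mq by (auto simp: m0_def q0_def)
  define M where "M = (\<Prod>l<r. m0 l)"
  have M0: "M \<noteq> 0" using m0 by (simp add: M_def)
  define e where "e = (\<lambda>l. \<Prod>i\<in>{..<r} - {l}. m0 i)"
  define q where "q = (\<lambda>l. Polynomial.smult (e l) (q0 l))"
  define t where "t = (\<lambda>l. Polynomial.smult (e l) (pseudo_mod (c l) ?d))"
  have Mc: "[:M:] * c l = ?d * q l + t l" if "l < r" for l
  proof -
    have "M = e l * m0 l"
      using that unfolding M_def e_def by (subst prod.remove[of _ l]) (auto simp: mult.commute)
    thus ?thesis
      using arg_cong[OF q0[of l], of "Polynomial.smult (e l)"]
      by (simp add: q_def t_def smult_add_right)
  qed
  have t_deg: "t l = 0 \<or> degree (t l) < degree ?d" for l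
    using pseudo_mod(2)[OF d0, of "c l"] by (auto simp: t_def)
  define w' where "w' = [:M:] \<cdot>\<^sub>v w + (- 1) \<cdot>\<^sub>v comb r q v"
  have w'K: "w' \<in> K" unfolding w'_def by (intro K_add K_smult w comb_in_K vK)
  have w'k: "w' $ k = [:M:] * w $ k - (\<Sum>l<r. q l * v l $ k)" if "k < s" for k
    using that wc by (simp add: w'_def comb_def)
  have dw': "?d * w' $ k = (\<Sum>l<r. t l * v l $ k)" if k: "k < s" for k
  proof -
    have "?d * w $ k = (\<Sum>l<r. c l * v l $ k)"
      using arg_cong[OF c, of "\<lambda>x. x $ k"] k wc by (simp add: comb_def)
    moreover have "?d * w' $ k = [:M:] * (?d * w $ k) - ?d * (\<Sum>l<r. q l * v l $ k)"
      unfolding w'k[OF k] right_diff_distrib by (simp only: mult.left_commute)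
    ultimately
    have "?d * w' $ k = [:M:] * (\<Sum>l<r. c l * v l $ k) - ?d * (\<Sum>l<r. q l * v l $ k)"
      by (simp only:)
    also have "\<dots> = (\<Sum>l<r. ([:M:] * c l - ?d * q l) * v l $ k)"
      by (simp only: sum_distrib_left sum_subtractf[symmetric] left_diff_distrib mult.assoc)
    also have "\<dots> = (\<Sum>l<r. t l * v l $ k)"
      by (intro sum.cong refl arg_cong2[of _ _ _ _ "(*)"])
        (simp_all only: Mc add_diff_cancel_left' lessThan_iff)
    finally show ?thesis .
  qed
  have t0: "t j = 0" if j: "j < r" for j
  proof (rule ccontr)
    assume nz: "t j \<noteq> 0"
    have "?d * minor r I (v(j := w')) = t j * ?d"
      by (rule minor_replace[OF j]) (simp add: dw' Is)
    hence eq: "minor r I (v(j := w')) = t j" using d0 by simp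
    hence "frame r I (v(j := w'))" using frame_update[OF fr w'K] nz by simp
    moreover have "(t j, ?d) \<in> smaller" using t_deg[of j] nz by (simp add: smaller_def)
    ultimately show False using red eq by (auto simp: reduced_frame_def)
  qed
  have w'0: "[:M:] * w $ k = (\<Sum>l<r. q l * v l $ k)" if k: "k < s" for k
    using dw'[OF k] t0 d0 w'k[OF k] by simp
  show ?thesis
  proof (rule that[of "\<bar>M\<bar>" "\<lambda>l. [:sgn M:] * q l"])
    show "[:\<bar>M\<bar>:] \<cdot>\<^sub>v w = comb r (\<lambda>l. [:sgn M:] * q l) v"
    proof (rule eq_vecI)
      fix k assume "k < dim_vec (comb r (\<lambda>l. [:sgn M:] * q l) v)"
      hence k: "k < s" by (simp add: comb_def)
      have "[:\<bar>M\<bar>:] * w $ k = [:sgn M:] * ([:M:] * w $ k)"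
        by (simp add: abs_sgn mult.commute)
      also have "\<dots> = (\<Sum>l<r. [:sgn M:] * q l * v l $ k)"
        by (simp only: w'0[OF k] sum_distrib_left mult.assoc)
      finally show "([:\<bar>M\<bar>:] \<cdot>\<^sub>v w) $ k = comb r (\<lambda>l. [:sgn M:] * q l) v $ k"
        using k wc by (simp add: comb_def)
    qed (use wc in \<open>simp add: comb_def\<close>)
  qed (use M0 in simp)
qed

text \<open>
  The Euclidean algorithm in \<open>\<F>\<^sub>p[x]\<close>, carried out with representatives in \<open>\<int>[x]\<close>. The induction is on
  the total size of the coefficients and runs over all reduced frames at once, since the frame
  changes along with the relation.
\<close>

lemma reduced_frame_relation_mod_prime:
  fixes p :: int
  assumes p: "prime p" and red: "reduced_frame r I v"
    and rel: "\<And>k. k < s \<Longrightarrow> [:p:] dvd (\<Sum>l<r. c l * v l $ k)"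
    and j: "j < r"
  shows "[:p:] dvd c j"
  using red rel j
proof (induction "\<Sum>l<r. if c l = 0 then 0 else Suc (degree (c l))"
    arbitrary: c v j rule: less_induct)
  case less
  let ?size = "\<lambda>f::int poly. if f = 0 then 0 else Suc (degree f)"
  note IH = less.hyps
  have fr: "frame r I v" using less.prems(1) by (simp add: reduced_frame_def)
  hence vK: "\<And>l. l < r \<Longrightarrow> v l \<in> K" and Is: "\<And>l. l < r \<Longrightarrow> I l < s" and d0: "minor r I v \<noteq> 0"
    by (auto simp: frame_def)
  have pp: "prime_elem [:p:]" using p by (intro lift_prime_elem_poly) auto
  have lower: "?size (f - g) < ?size f"
    if "f \<noteq> 0" "degree g \<le> degree f" "coeff g (degree f) = lead_coeff f" for f g :: "int poly"
  proof -
    have "degree (f - g) \<le> degree f" using that by (intro degree_diff_le) auto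
    hence "f - g = 0 \<or> degree (f - g) < degree f"
      using that by (intro eq_zero_or_degree_less) auto
    thus ?thesis using that by auto
  qed
  have step: "\<forall>l<r. [:p:] dvd (c(i := f)) l"
    if "i < r" and "?size f < ?size (c i)" and "reduced_frame r I v'"
      and "\<And>k. k < s \<Longrightarrow> [:p:] dvd (\<Sum>l<r. (c(i := f)) l * v' l $ k)" for i f v'
  proof -
    have "(\<Sum>l<r. ?size ((c(i := f)) l)) < (\<Sum>l<r. ?size (c l))"
      using that(1,2) by (intro sum_strict_mono_ex1) auto
    from IH[OF this that(3,4)] show ?thesis by blast
  qed
  have sum_upd: "(\<Sum>l<r. (c(i := f)) l * x l) = (\<Sum>l<r. c l * x l) + (f - c i) * x i"
    if "i < r" for i f and x :: "nat \<Rightarrow> int poly"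
    using that by (simp add: sum.remove[of "{..<r}" i] algebra_simps)
  show ?case
  proof (cases "\<exists>i<r. c i \<noteq> 0 \<and> p dvd lead_coeff (c i)")
    case True
    then obtain i where i: "i < r" "c i \<noteq> 0" and pl: "p dvd lead_coeff (c i)" by blast
    \<comment> \<open>A leading term that vanishes modulo \<open>p\<close> can simply be cut off.\<close>
    define g where "g = monom (lead_coeff (c i)) (degree (c i))"
    have pg: "[:p:] dvd g" using pl by (auto simp: const_poly_dvd_iff g_def)
    have "\<forall>l<r. [:p:] dvd (c(i := c i - g)) l"
    proof (rule step[OF i(1) _ less.prems(1)])
      show "?size (c i - g) < ?size (c i)"
        by (rule lower[OF i(2)]) (auto simp: g_def degree_monom_le)
      fix k assume "k < s"
      from dvd_diff[OF less.prems(2)[OF this] dvd_mult2[OF pg, of "v i $ k"]]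
      show "[:p:] dvd (\<Sum>l<r. (c(i := c i - g)) l * v l $ k)"
        by (simp only: sum_upd[OF i(1)]) simp
    qed
    hence "[:p:] dvd (c(i := c i - g)) j" using less.prems(3) by blast
    thus ?thesis using pg dvd_add[of "[:p:]" "c i - g" g] by (auto split: if_splits)
  next
    case unit_leads: False
    have not_dvd: "\<not> [:p:] dvd c i" if "i < r" "c i \<noteq> 0" for i
      using unit_leads that by (auto simp: const_poly_dvd_iff)
    show ?thesis
    proof (cases "\<exists>i i'. i < r \<and> i' < r \<and> i \<noteq> i' \<and> c i \<noteq> 0 \<and> c i' \<noteq> 0")
      case True
      then obtain i i' where i: "i < r" "i' < r" "i \<noteq> i'" "c i \<noteq> 0" "c i' \<noteq> 0"
        and deg: "degree (c i') \<le> degree (c i)"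
        by (metis nat_le_linear)
      have "\<not> p dvd lead_coeff (c i')" using unit_leads i by blast
      hence "coprime (lead_coeff (c i')) p"
        using p by (metis coprime_commute prime_imp_coprime)
      then obtain b y where b: "b * lead_coeff (c i') + y * p = 1"
        using bezout_int[of "lead_coeff (c i')" p] by auto
      \<comment> \<open>One division step modulo \<open>p\<close>: the coefficient of \<open>v i\<close> becomes \<open>c i - t * c i'\<close>, which is
        compensated by adding \<open>t\<close> times \<open>v i\<close> to \<open>v i'\<close>. The leading coefficient is now
        divisible by \<open>p\<close> but need not be zero, so the term \<open>g\<close> is removed as well.\<close>
      define q where "q = lead_coeff (c i) * b"
      have "lead_coeff (c i) - q * lead_coeff (c i')
          = lead_coeff (c i) * (1 - b * lead_coeff (c i'))"
        by (simp add: q_def algebra_simps)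
      also have "1 - b * lead_coeff (c i') = y * p" using b by linarith
      finally have pq: "p dvd lead_coeff (c i) - q * lead_coeff (c i')" by simp
      define t where "t = monom q (degree (c i) - degree (c i'))"
      define g where
        "g = monom (lead_coeff (c i) - q * lead_coeff (c i')) (degree (c i))"
      have pg: "[:p:] dvd g" using pq by (auto simp: const_poly_dvd_iff g_def)
      define u where "u = v i' + t \<cdot>\<^sub>v v i"
      have car: "v i \<in> carrier_vec s" "v i' \<in> carrier_vec s" using vK i K_carrier by auto
      have uk: "u $ k = v i' $ k + t * v i $ k" if "k < s" for k
        using that car by (simp add: u_def)
      have uK: "u \<in> K" unfolding u_def using vK i by (intro K_add K_smult) auto
      define e where "e = (\<lambda>_. 0 :: int poly)(i := t, i' := 1)"
      have "1 * minor r I (v(i' := u)) = e i' * minor r I v"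
      proof (rule minor_replace[OF i(2), where c = e])
        fix k assume "k < r"
        have "(\<Sum>l<r. e l * v l $ I k) = (\<Sum>l\<in>{i, i'}. e l * v l $ I k)"
          using i by (intro sum.mono_neutral_right) (auto simp: e_def)
        also have "\<dots> = 1 * u $ I k" using i uk[OF Is[OF \<open>k < r\<close>]] by (simp add: e_def)
        finally show "1 * u $ I k = (\<Sum>l<r. e l * v l $ I k)" ..
      qed
      hence same: "minor r I (v(i' := u)) = minor r I v" by (simp add: e_def)
      have red': "reduced_frame r I (v(i' := u))"
        using less.prems(1) frame_update[OF fr uK, of i'] d0
        unfolding reduced_frame_def same by simp
      have "\<forall>l<r. [:p:] dvd (c(i := c i - (t * c i' + g))) l"
      proof (rule step[OF i(1) _ red'])
        have "degree (t * c i') \<le> degree (c i)"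
          using degree_mult_le[of t "c i'"] degree_monom_le[of q "degree (c i) - degree (c i')"] deg
          unfolding t_def by linarith
        moreover have "coeff (t * c i') (degree (c i)) = q * lead_coeff (c i')"
          using deg by (simp add: t_def coeff_monom_mult)
        ultimately show "?size (c i - (t * c i' + g)) < ?size (c i)"
          by (intro lower[OF i(4)] degree_add_le) (auto simp: g_def degree_monom_le)
        fix k assume k: "k < s"
        have "(\<Sum>l<r. (c(i := c i - (t * c i' + g))) l * (v(i' := u)) l $ k)
            = (\<Sum>l<r. c l * (v(i' := u)) l $ k)
              + (c i - (t * c i' + g) - c i) * (v(i' := u)) i $ k"
          by (rule sum_upd[OF i(1)])
        also have "(\<Sum>l<r. c l * (v(i' := u)) l $ k)
            = (\<Sum>l<r. c l * v l $ k) + c i' * t * v i $ k"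
          using i(2) uk[OF k] by (simp add: sum.remove[of "{..<r}" i'] algebra_simps)
        finally have "(\<Sum>l<r. (c(i := c i - (t * c i' + g))) l * (v(i' := u)) l $ k)
            = (\<Sum>l<r. c l * v l $ k) - g * v i $ k"
          using i(3) by (simp add: algebra_simps)
        thus "[:p:] dvd (\<Sum>l<r. (c(i := c i - (t * c i' + g))) l * (v(i' := u)) l $ k)"
          using less.prems(2)[OF k] pg by simp
      qed
      \<comment> \<open>The untouched coefficient \<open>c i'\<close> would have to vanish modulo \<open>p\<close>.\<close>
      hence "[:p:] dvd (c(i := c i - (t * c i' + g))) i'" using i by blast
      thus ?thesis using i not_dvd by simp
    next
      case single: False
      show ?thesis
      proof (rule ccontr)
        assume nd: "\<not> [:p:] dvd c j"
        hence nz: "c j \<noteq> 0" by auto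
        have j: "j < r" by (rule less.prems(3))
        have jc: "v j \<in> carrier_vec s" using vK[OF j] K_carrier by auto
        have "[:p:] dvd v j $ k" if k: "k < s" for k
        proof -
          have "(\<Sum>l<r. c l * v l $ k) = (\<Sum>l\<in>{j}. c l * v l $ k)"
            using single nz j by (intro sum.mono_neutral_right) auto
          hence "[:p:] dvd c j * v j $ k" using less.prems(2)[OF k] by simp
          thus ?thesis using pp nd prime_elem_dvd_mult_iff by blast
        qed
        then obtain x where x: "\<And>k. k < s \<Longrightarrow> v j $ k = [:p:] * x k"
          unfolding dvd_def by metis
        define u where "u = vec s x"
        have pu: "[:p:] \<cdot>\<^sub>v u = v j" using x jc by (intro eq_vecI) (auto simp: u_def)
        have "u \<in> K"
          by (rule K_pure[OF p]) (use pu vK[OF j] in \<open>auto simp: u_def\<close>)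
        define e where "e = (\<lambda>_. 0 :: int poly)(j := 1)"
        have "[:p:] * minor r I (v(j := u)) = e j * minor r I v"
        proof (rule minor_replace[OF j, where c = e])
          fix i assume "i < r"
          have "(\<Sum>l<r. e l * v l $ I i) = (\<Sum>l\<in>{j}. e l * v l $ I i)"
            using j by (intro sum.mono_neutral_right) (auto simp: e_def)
          also have "\<dots> = [:p:] * u $ I i"
            using x Is[OF \<open>i < r\<close>] by (simp add: u_def e_def)
          finally show "[:p:] * u $ I i = (\<Sum>l<r. e l * v l $ I i)" ..
        qed
        hence eq: "minor r I v = Polynomial.smult p (minor r I (v(j := u)))" by (simp add: e_def)
        with d0 have nz': "minor r I (v(j := u)) \<noteq> 0" by auto
        have p1: "p > 1" using p by (rule prime_gt_1_int)
        let ?a = "\<bar>lead_coeff (minor r I (v(j := u)))\<bar>"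
        have "1 * ?a < p * ?a"
          by (rule mult_strict_right_mono[OF p1]) (use nz' in simp)
        hence "(minor r I (v(j := u)), minor r I v) \<in> smaller"
          unfolding eq smaller_def using p1 nz' by (simp add: abs_mult)
        moreover have "frame r I (v(j := u))" using frame_update[OF fr \<open>u \<in> K\<close> nz'] .
        ultimately show False using less.prems(1) by (auto simp: reduced_frame_def)
      qed
    qed
  qed
qed

text \<open>
  The least positive integer that multiplies \<open>w\<close> into the span is \<open>1\<close>: for a prime divisor \<open>p\<close>,
  the relation is trivial modulo \<open>p\<close> and may be divided by \<open>p\<close>.
\<close>

lemma in_span:
  assumes red: "reduced_frame r I v" and max: "\<And>I' v'. \<not> frame (Suc r) I' v'"
    and w: "w \<in> K"
  obtains c where "w = comb r c v"
proof -
  define P where "P = (\<lambda>m::nat. m > 0 \<and> (\<exists>c. [:int m:] \<cdot>\<^sub>v w = comb r c v))"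
  have wc: "w \<in> carrier_vec s" using w K_carrier by auto
  obtain m0 c0 where "m0 > 0" "[:m0:] \<cdot>\<^sub>v w = comb r c0 v"
    using multiple_in_span[OF red max w] by blast
  hence "P (nat m0)" by (auto simp: P_def)
  define m where "m = (LEAST m. P m)"
  have "P m" unfolding m_def by (rule LeastI) fact
  then obtain c where m: "m > 0" and c: "[:int m:] \<cdot>\<^sub>v w = comb r c v"
    by (auto simp: P_def)
  have "m = 1"
  proof (rule ccontr)
    assume "m \<noteq> 1"
    then obtain p where p: "prime p" "p dvd m" using prime_factor_nat by blast
    then obtain n where n: "m = p * n" by blast
    have ck: "[:int p:] * ([:int n:] * w $ k) = (\<Sum>l<r. c l * v l $ k)" if "k < s" for k
      using arg_cong[OF c, of "\<lambda>x. x $ k"] that wc by (simp add: comb_def n mult.commute)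
    have "[:int p:] dvd c l" if "l < r" for l
      by (rule reduced_frame_relation_mod_prime[OF _ red _ that])
        (use p in \<open>auto simp flip: ck simp del: mult_pCons_left\<close>)
    then obtain c' where c': "\<And>l. l < r \<Longrightarrow> c l = [:int p:] * c' l"
      unfolding dvd_def by metis
    have "[:int n:] \<cdot>\<^sub>v w = comb r c' v"
    proof (rule eq_vecI)
      fix k assume "k < dim_vec (comb r c' v)"
      hence k: "k < s" by (simp add: comb_def)
      have "[:int p:] * ([:int n:] * w $ k) = [:int p:] * (\<Sum>l<r. c' l * v l $ k)"
        unfolding ck[OF k] sum_distrib_left by (intro sum.cong) (auto simp: c')
      hence "[:int n:] * w $ k = (\<Sum>l<r. c' l * v l $ k)"
        using prime_gt_0_nat[OF p(1)] by (subst (asm) mult_cancel_left) simp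
      thus "([:int n:] \<cdot>\<^sub>v w) $ k = comb r c' v $ k" using k wc by (simp add: comb_def)
    qed (use wc in \<open>simp add: comb_def\<close>)
    hence "P n" using m n by (auto simp: P_def)
    hence "m \<le> n" unfolding m_def by (rule Least_le)
    thus False using n m prime_gt_1_nat[OF p(1)] by simp
  qed
  hence "w = [:int m:] \<cdot>\<^sub>v w" using wc by (intro eq_vecI) auto
  with c have "w = comb r c v" by simp
  thus ?thesis by (rule that)
qed

lemma frame_independent:
  assumes fr: "frame r I v" and zero: "comb r c v = 0\<^sub>v s" and j: "j < r"
  shows "c j = 0"
proof -
  have "0 * minor r I (v(j := v j)) = c j * minor r I v"
  proof (rule minor_replace[OF j])
    fix i assume "i < r"
    hence "I i < s" using fr by (simp add: frame_def)
    thus "0 * v j $ I i = (\<Sum>l<r. c l * v l $ I i)"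
      using arg_cong[OF zero, of "\<lambda>x. x $ I i"] by (simp add: comb_def)
  qed
  thus ?thesis using fr by (simp add: frame_def)
qed

lemma obtain_basis:
  obtains r v where "\<And>l. l < r \<Longrightarrow> v l \<in> K"
    and "\<And>w. w \<in> K \<Longrightarrow> \<exists>c. w = comb r c v"
    and "\<And>c j. comb r c v = 0\<^sub>v s \<Longrightarrow> j < r \<Longrightarrow> c j = 0"
proof -
  obtain r I v where red: "reduced_frame r I v" and max: "\<And>I' v'. \<not> frame (Suc r) I' v'"
    using obtain_reduced_frame by blast
  have fr: "frame r I v" using red by (simp add: reduced_frame_def)
  show ?thesis
  proof (rule that[of r v])
    show "v l \<in> K" if "l < r" for l using fr that by (simp add: frame_def)
    show "\<exists>c. w = comb r c v" if "w \<in> K" for w using in_span[OF red max that] by blast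
    show "c j = 0" if "comb r c v = 0\<^sub>v s" "j < r" for c j
      using frame_independent[OF fr that] .
  qed
qed

section \<open>Freeness\<close>

abbreviation K_module where
  "K_module \<equiv> (module_vec TYPE(int poly) s)\<lparr>carrier := K\<rparr>"

lemma free: "free_module (class_ring :: int poly ring) K_module"
proof -
  interpret V: vec_module "TYPE(int poly)" s .
  have sub: "LinearCombinations.submodule (class_ring :: int poly ring) K V.V"
    by (intro LinearCombinations.submodule.intro V.module_axioms)
      (auto simp: module_vec_simps K_carrier K_zero K_add K_smult)
  obtain r v where vK: "\<And>l. l < r \<Longrightarrow> v l \<in> K"
    and gen: "\<And>w. w \<in> K \<Longrightarrow> \<exists>c. w = comb r c v"
    and indep: "\<And>c j. comb r c v = 0\<^sub>v s \<Longrightarrow> j < r \<Longrightarrow> c j = 0"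
    using obtain_basis by blast
  define B where "B = v ` {..<r}"
  have BK: "B \<subseteq> K" using vK by (auto simp: B_def)
  have inj: "inj_on v {..<r}"
  proof (rule inj_onI, rule ccontr)
    fix i j assume ij: "i \<in> {..<r}" "j \<in> {..<r}" "v i = v j" "i \<noteq> j"
    let ?c = "(\<lambda>_. 0)(i := 1, j := - 1)"
    have "(\<Sum>l<r. ?c l * v l $ k) = (\<Sum>l\<in>{i, j}. ?c l * v l $ k)" for k
      using ij by (intro sum.mono_neutral_right) auto
    hence "comb r ?c v = 0\<^sub>v s" using ij by (auto simp: comb_def)
    from indep[OF this, of j] ij show False by simp
  qed
  have lincomb: "V.lincomb a A = comb r (\<lambda>l. if v l \<in> A then a (v l) else 0) v"
    if A: "A \<subseteq> B" for a A
  proof (rule eq_vecI)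
    have AV: "A \<subseteq> carrier_vec s" using A BK K_carrier by blast
    thus "dim_vec (V.lincomb a A) = dim_vec (comb r (\<lambda>l. if v l \<in> A then a (v l) else 0) v)"
      using V.lincomb_closed[OF AV, of a] by (simp add: comb_def)
    fix k assume "k < dim_vec (comb r (\<lambda>l. if v l \<in> A then a (v l) else 0) v)"
    hence k: "k < s" by (simp add: comb_def)
    have A_eq: "A = v ` {l. l < r \<and> v l \<in> A}" using A by (auto simp: B_def)
    have "V.lincomb a A $ k = (\<Sum>w\<in>A. a w * w $ k)"
      using V.finsum_index[OF k _ AV, of "\<lambda>w. a w \<cdot>\<^sub>v w"] AV k
      by (auto simp: V.lincomb_def subset_iff intro!: sum.cong)
    also have "\<dots> = (\<Sum>w\<in>v ` {l. l < r \<and> v l \<in> A}. a w * w $ k)"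
      by (rule sum.cong[OF A_eq refl])
    also have "\<dots> = (\<Sum>l | l < r \<and> v l \<in> A. a (v l) * v l $ k)"
      by (subst sum.reindex) (auto intro: inj_on_subset[OF inj])
    also have "\<dots> = (\<Sum>l<r. (if v l \<in> A then a (v l) else 0) * v l $ k)"
      by (intro sum.mono_neutral_cong_left) auto
    finally show "V.lincomb a A $ k = comb r (\<lambda>l. if v l \<in> A then a (v l) else 0) v $ k"
      using k by (simp add: comb_def)
  qed
  have "\<not> V.lin_dep B"
  proof
    assume "V.lin_dep B"
    then obtain A a w where A: "A \<subseteq> B" "V.lincomb a A = 0\<^sub>v s" "w \<in> A" "a w \<noteq> 0"
      unfolding V.lin_dep_def by blast
    then obtain j where j: "j < r" "w = v j" by (auto simp: B_def)
    from indep[OF _ j(1), of "\<lambda>l. if v l \<in> A then a (v l) else 0"] A j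
    show False by (simp add: lincomb)
  qed
  moreover have "V.span B = K"
  proof
    show "V.span B \<subseteq> K"
      using comb_in_K[of r v] vK by (auto simp: V.span_def lincomb)
    show "K \<subseteq> V.span B"
    proof
      fix w assume "w \<in> K"
      then obtain c where c: "w = comb r c v" using gen by blast
      have "V.lincomb (c \<circ> the_inv_into {..<r} v) B = comb r c v"
        unfolding lincomb[OF subset_refl]
        by (auto simp: comb_def B_def the_inv_into_f_f[OF inj] intro!: eq_vecI sum.cong)
      hence "w = V.lincomb (c \<circ> the_inv_into {..<r} v) B" using c by simp
      thus "w \<in> V.span B" unfolding V.span_def B_def by blast
    qed
  qed
  ultimately show ?thesis
    unfolding free_module_def
    using V.submodule_is_module[OF sub] V.span_li_not_depend[OF BK sub] BK
    by (intro conjI exI[of _ B]) auto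
qed

end

text \<open>
  Purity of the kernel: \<open>F (p v) = 0\<close> forces \<open>F v = 0\<close>, because \<open>\<int>[x]\<close> has no zero divisors.
\<close>

theorem lemma3p16:
  fixes F :: "int poly mat" and n s :: nat
  assumes "F \<in> carrier_mat n s"
  shows "free_module (class_ring :: int poly ring) (kernel_module F)"
proof -
  interpret pure_submodule s "mat_kernel F"
  proof
    fix p :: int and v :: "int poly vec"
    assume p: "prime p" and v: "v \<in> carrier_vec s" and "[:p:] \<cdot>\<^sub>v v \<in> mat_kernel F"
    hence "F *\<^sub>v ([:p:] \<cdot>\<^sub>v v) = 0\<^sub>v n" using mat_kernelD(2)[OF assms] by blast
    moreover have "F *\<^sub>v (a \<cdot>\<^sub>v v) = a \<cdot>\<^sub>v (F *\<^sub>v v)" for a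
      using assms v by auto
    ultimately have pFv: "[:p:] \<cdot>\<^sub>v (F *\<^sub>v v) = 0\<^sub>v n" by simp
    have "[:p:] * (F *\<^sub>v v) $ i = 0" if "i < n" for i
    proof -
      have "[:p:] * (F *\<^sub>v v) $ i = ([:p:] \<cdot>\<^sub>v (F *\<^sub>v v)) $ i"
        using that by (subst index_smult_vec) (simp_all add: carrier_matD(1)[OF assms])
      also have "\<dots> = 0" using that unfolding pFv by simp
      finally show ?thesis .
    qed
    hence "(F *\<^sub>v v) $ i = 0" if "i < n" for i
      using that p by (metis mult_eq_0_iff not_prime_0 pCons_eq_0_iff)
    thus "v \<in> mat_kernel F"
      using assms v by (intro mat_kernelI[OF assms v] eq_vecI) auto
  next
    show "mat_kernel F \<subseteq> carrier_vec s" by (rule mat_kernel_carrier[OF assms])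
    show "0\<^sub>v s \<in> mat_kernel F" using assms by (intro mat_kernelI[OF assms]) auto
    show "a \<cdot>\<^sub>v v \<in> mat_kernel F" if "v \<in> mat_kernel F" for a v
      by (rule mat_kernel_smult[OF assms that])
    show "u + v \<in> mat_kernel F" if "u \<in> mat_kernel F" "v \<in> mat_kernel F" for u v
      using that assms by (auto simp: mat_kernel[OF assms] mult_add_distrib_mat_vec[OF assms])
  qed
  show ?thesis using free assms by (simp add: kernel_module_def)
qed

end
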